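(* For every $n\ge0$, the diagonal vector $D_n=U_n^{(n)}$ satisfies $$D_n=\frac{(n!)^7}{2^n}\left(\frac{21}{4}C_n,\;A_n\right).$$
   Context: The sequences of rational numbers $A=(A_n)_{n\ge0}$ and $C=(C_n)_{n\ge0}$ are the solutions of $$4n^2(16n^2-1)u_{n-1}-(65n^4+130n^3+105n^2+40n+6)u_n+(n+1)^4u_{n+1}=0\qquad(n\ge1)$$ with initial values $(A_0,A_1)=(1,6)$ and $(C_0,C_1)=(0,1)$. For $m\ge0$ put $$E_m=\sum_{n=1}^m\frac{(-1)^{n-1}}{n^3}\ (E_0=0),\qquad h_m=\frac{(m!)^2(2m)!}{8^m}.$$ For $k,m\ge0$ put $$\rho_m^{(k)}=\frac{(m-2k-2)(2m+2k+1)\bigl(m^2-2(k+1)m+4(k+1)^2\bigr)}4,\qquad T_m^{(k)}=\frac{2}{2m-2k-1}.$$ The vectors $U_m^{(k)}\in\mathbb Q^2$ ($k,m\ge0$) are defined by $U_m^{(0)}=h_m(E_m,1)$ and $$U_m^{(k+1)}=T_m^{(k)}\left(U_{m+1}^{(k)}+\rho_{m+1}^{(k)}U_m^{(k)}\right).$$ *)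

theory Defs
  imports "HOL-Analysis.Cartesian_Space"
begin

definition solves_recurrence :: "(nat \<Rightarrow> rat) \<Rightarrow> bool" where
  "solves_recurrence u \<longleftrightarrow> (\<forall>n\<ge>1. let x = of_nat n :: rat in
     4 * x^2 * (16 * x^2 - 1) * u (n - 1)
     - (65 * x^4 + 130 * x^3 + 105 * x^2 + 40 * x + 6) * u n
     + (x + 1)^4 * u (n + 1) = 0)"

definition E :: "nat \<Rightarrow> rat" where
  "E m = (\<Sum>n = 1..m. (-1)^(n - 1) / of_nat n ^ 3)"

definition h :: "nat \<Rightarrow> rat" where
  "h m = (fact m)^2 * fact (2 * m) / 8^m"

text \<open>The upper index \<open>k\<close> comes first. All differences are taken in the rationals,
  so there is no truncated subtraction.\<close>

definition \<rho> :: "nat \<Rightarrow> nat \<Rightarrow> rat" where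
  "\<rho> k m = (let x = of_nat m; y = of_nat k in
     (x - 2 * y - 2) * (2 * x + 2 * y + 1) * (x^2 - 2 * (y + 1) * x + 4 * (y + 1)^2) / 4)"

definition T :: "nat \<Rightarrow> nat \<Rightarrow> rat" where
  "T k m = 2 / (2 * of_nat m - 2 * of_nat k - 1)"

fun U :: "nat \<Rightarrow> nat \<Rightarrow> rat ^ 2" where
  "U 0 m = h m *s vector [E m, 1]"
| "U (Suc k) m = T k m *s (U k (m + 1) + \<rho> k (m + 1) *s U k m)"

definition D :: "nat \<Rightarrow> rat ^ 2" where
  "D n = U n n"

end

theory Submission
  imports Defs
begin

text \<open>For each fixed \<open>k\<close> the vectors \<open>U k m\<close> satisfy a three-term recurrence in \<open>m\<close> with
  polynomial coefficients. The passage from \<open>k\<close> to \<open>k + 1\<close> preserves its shape, which gives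
  an induction on \<open>k\<close>. With it, \<open>D n\<close>, \<open>D (n + 1)\<close> and \<open>D (n + 2)\<close> all become combinations of
  \<open>U n n\<close> and \<open>U n (n + 1)\<close>; eliminating the latter leaves the recurrence of \<open>A\<close> and \<open>C\<close>,
  up to the factor \<open>(n!)\<^sup>7 / 2\<^sup>n\<close>.\<close>

text \<open>\<open>y\<close> stands for the upper index and \<open>x\<close> for the lower one. Both
  are rational, so index shifts become substitutions into polynomials and \<open>algebra\<close>
  applies.\<close>

definition \<alpha> :: "rat \<Rightarrow> rat \<Rightarrow> rat" where
  "\<alpha> y x = (2 * y + 1) * (2 * x + 3) * (3 * x^2 + 9 * x + 7) / 4"

definition \<beta> :: "rat \<Rightarrow> rat \<Rightarrow> rat" where
  "\<beta> y x = (2 * x + 1 - 2 * y) * (2 * x + 3 + 2 * y) * (x + 1)^6 / 16"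

definition r :: "rat \<Rightarrow> rat \<Rightarrow> rat" where
  "r y x = (x - 2 * y - 2) * (2 * x + 2 * y + 1) * (x^2 - 2 * (y + 1) * x + 4 * (y + 1)^2) / 4"

lemma \<rho>_eq: "\<rho> k m = r (of_nat k) (of_nat m)"
  by (simp add: \<rho>_def r_def Let_def)

text \<open>By parity; this keeps the denominators in \<open>T\<close> away from zero.\<close>

lemma odd_of_nat_neq_0: "2 * (of_nat m :: rat) - 2 * of_nat k + of_int c \<noteq> 0" if "odd c"
proof
  assume "2 * (of_nat m :: rat) - 2 * of_nat k + of_int c = 0"
  then have "(of_int (2 * int m - 2 * int k + c) :: rat) = 0"
    by simp
  then have "2 * int m - 2 * int k + c = 0"
    by (simp only: of_int_eq_0_iff)
  with that show False by presburger
qed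

lemma U_Suc_component:
  "U (Suc k) m $ i = 2 / (2 * of_nat m - 2 * of_nat k - 1) *
     (U k (Suc m) $ i + r (of_nat k) (of_nat m + 1) * U k m $ i)"
  by (simp add: T_def \<rho>_eq add.commute)

declare U.simps(2) [simp del]

lemma h_Suc: "h (Suc m) = (of_nat m + 1)^3 * (2 * of_nat m + 1) / 4 * h m"
proof -
  have "(fact (2 * Suc m) :: rat) = (2 * of_nat m + 2) * (2 * of_nat m + 1) * fact (2 * m)"
    by (simp add: algebra_simps)
  then show ?thesis
    unfolding h_def by (simp add: power2_eq_square power3_eq_cube field_simps)
qed

lemma E_Suc: "E (Suc m) = E m + (-1)^m / (of_nat m + 1)^3"
  by (simp add: E_def add.commute)

text \<open>Both components rest on (x + 2)^3 - (x + 1)^3 = 3 * x^2 + 9 * x + 7, the quadratic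
  factor of \<open>\<alpha>\<close>.\<close>

lemma U_recurrence_0:
  "U 0 (m + 2) $ i = \<alpha> 0 (of_nat m) * U 0 (m + 1) $ i + \<beta> 0 (of_nat m) * U 0 m $ i"
proof -
  define x where "x = (of_nat m :: rat)"
  have x: "x + 1 \<noteq> 0" "x + 2 \<noteq> 0"
    unfolding x_def by linarith+
  have h1: "h (Suc m) = (x + 1)^3 * (2 * x + 1) / 4 * h m"
    by (simp add: h_Suc x_def)
  have h2: "h (Suc (Suc m)) = (x + 2)^3 * (2 * x + 3) / 4 * h (Suc m)"
    by (simp add: h_Suc [of "Suc m"] x_def add.commute)
  have E1: "E (Suc m) = E m + (-1)^m / (x + 1)^3"
    by (simp add: E_Suc x_def)
  have E2: "E (Suc (Suc m)) = E m + (-1)^m / (x + 1)^3 - (-1)^m / (x + 2)^3"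
    by (simp add: E_Suc [of "Suc m"] E1) (simp add: x_def add.commute)
  have second: "h (Suc (Suc m)) = \<alpha> 0 x * h (Suc m) + \<beta> 0 x * h m"
    unfolding h2 h1 \<alpha>_def \<beta>_def by algebra
  \<comment> \<open>Since \<open>h\<close> itself solves the recurrence, \<open>E m\<close> can be
    subtracted from all three sums; the term with \<open>\<beta>\<close> then drops out.\<close>
  have "h (Suc (Suc m)) * ((-1)^m / (x + 1)^3 - (-1)^m / (x + 2)^3)
      = \<alpha> 0 x * h (Suc m) * ((-1)^m / (x + 1)^3)"
    unfolding h2 \<alpha>_def using x by (simp add: divide_simps) algebra
  then have "h (Suc (Suc m)) * E (Suc (Suc m))
      = h (Suc (Suc m)) * E m + \<alpha> 0 x * h (Suc m) * ((-1)^m / (x + 1)^3)"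
    unfolding E2 by (simp add: algebra_simps)
  also have "\<dots> = \<alpha> 0 x * (h (Suc m) * E (Suc m)) + \<beta> 0 x * (h m * E m)"
    unfolding second E1 by (simp add: algebra_simps)
  finally have first: "h (Suc (Suc m)) * E (Suc (Suc m))
      = \<alpha> 0 x * (h (Suc m) * E (Suc m)) + \<beta> 0 x * (h m * E m)" .
  from first second show ?thesis
    unfolding x_def using exhaust_2 [of i] by auto
qed

text \<open>Here \<open>p\<close>, \<open>q\<close>, \<open>s\<close>, \<open>t\<close> are four
  consecutive values in row \<open>k\<close>. Once \<open>s\<close> and \<open>t\<close> are
  eliminated, both sides are linear in \<open>p\<close> and \<open>q\<close>, and their coefficients
  are compared.\<close>

lemma ladder_identity:
  fixes x y p q :: rat
  assumes "2 * x - 2 * y - 1 \<noteq> 0" "2 * x - 2 * y + 1 \<noteq> 0" "2 * x - 2 * y + 3 \<noteq> 0"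
    and s: "s = \<alpha> y x * q + \<beta> y x * p"
    and t: "t = \<alpha> y (x + 1) * s + \<beta> y (x + 1) * q"
  shows "2 / (2 * x - 2 * y + 3) * (t + r y (x + 3) * s)
    = \<alpha> (y + 1) x * (2 / (2 * x - 2 * y + 1) * (s + r y (x + 2) * q))
      + \<beta> (y + 1) x * (2 / (2 * x - 2 * y - 1) * (q + r y (x + 1) * p))"
proof -
  \<comment> \<open>The first factor of \<open>\<beta> (y + 1) x\<close> is exactly the denominator
    of \<open>T k m\<close>. The other two denominators are cleared by multiplication.\<close>
  have b: "\<beta> (y + 1) x * (2 / (2 * x - 2 * y - 1))
    = (2 * x + 5 + 2 * y) * (x + 1)^6 / 8"
    using assms(1) by (simp add: \<beta>_def divide_simps) (simp add: algebra_simps)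
  have "(2 * x - 2 * y + 1) * (t + r y (x + 3) * s) * 2
    = (2 * x - 2 * y + 3) * (\<alpha> (y + 1) x * 2 * (s + r y (x + 2) * q)
      + (2 * x - 2 * y + 1) * ((2 * x + 5 + 2 * y) * (x + 1)^6 / 8 * (q + r y (x + 1) * p)))"
    unfolding t s \<alpha>_def \<beta>_def r_def by algebra
  then show ?thesis
    unfolding mult.assoc [symmetric] b using assms(2,3) by (simp add: field_simps)
qed

lemma U_recurrence:
  "U k (m + 2) $ i = \<alpha> (of_nat k) (of_nat m) * U k (m + 1) $ i
     + \<beta> (of_nat k) (of_nat m) * U k m $ i"
proof (induction k arbitrary: m)
  case 0
  then show ?case by (simp only: U_recurrence_0 of_nat_0)
next
  case (Suc k)
  define x y where "x = (of_nat m :: rat)" and "y = (of_nat k :: rat)"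
  have nz: "2 * x - 2 * y - 1 \<noteq> 0" "2 * x - 2 * y + 1 \<noteq> 0" "2 * x - 2 * y + 3 \<noteq> 0"
    using odd_of_nat_neq_0 [of "-1" m k] odd_of_nat_neq_0 [of 1 m k] odd_of_nat_neq_0 [of 3 m k]
    by (simp_all add: x_def y_def)
  have s: "U k (Suc (Suc m)) $ i = \<alpha> y x * U k (Suc m) $ i + \<beta> y x * U k m $ i"
    using Suc [of m] by (simp add: x_def y_def)
  have t: "U k (Suc (Suc (Suc m))) $ i
    = \<alpha> y (x + 1) * U k (Suc (Suc m)) $ i + \<beta> y (x + 1) * U k (Suc m) $ i"
    using Suc [of "Suc m"] by (simp add: x_def y_def add.commute)
  show ?case
    using ladder_identity [OF nz s t]
    by (simp add: U_Suc_component x_def y_def algebra_simps)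
qed

text \<open>With \<open>p\<close>, \<open>q\<close> the entries n and n + 1 of row n,
  \<open>d\<close> and \<open>e\<close> are the entries n + 1 and n + 2 of row n + 1. The factors 2
  and 2 / 3 are the values of \<open>T\<close> there. The multiple of \<open>d\<close> is chosen so
  that \<open>q\<close> cancels.\<close>

lemma diagonal_identity:
  fixes x y p q :: rat
  assumes s: "s = \<alpha> y y * q + \<beta> y y * p"
    and t: "t = \<alpha> y (y + 1) * s + \<beta> y (y + 1) * q"
    and d: "d = 2 * (s + r y (y + 2) * q)"
    and e: "e = 2 / 3 * (t + r y (y + 3) * s)"
    and x: "x = y + 1"
  shows "2 * (\<alpha> (y + 1) (y + 1) * e + \<beta> (y + 1) (y + 1) * d + r (y + 1) (y + 3) * e)
    = (65 * x^4 + 130 * x^3 + 105 * x^2 + 40 * x + 6) * (x + 1)^3 / 2 * d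
      - x^9 * (16 * x^2 - 1) * (x + 1)^3 * p"
  unfolding e d t s x \<alpha>_def \<beta>_def r_def by algebra

lemma diagonal_recurrence:
  fixes n :: nat
  defines "x \<equiv> of_nat n + 1 :: rat"
  shows "D (n + 2) $ i =
    (65 * x^4 + 130 * x^3 + 105 * x^2 + 40 * x + 6) * (x + 1)^3 / 2 * D (n + 1) $ i
    - x^9 * (16 * x^2 - 1) * (x + 1)^3 * D n $ i"
proof -
  define y where "y = (of_nat n :: rat)"
  define s t where "s = U n (Suc (Suc n)) $ i" and "t = U n (Suc (Suc (Suc n))) $ i"
  define d e where "d = U (Suc n) (Suc n) $ i" and "e = U (Suc n) (Suc (Suc n)) $ i"
  have s: "s = \<alpha> y y * U n (Suc n) $ i + \<beta> y y * U n n $ i"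
    using U_recurrence [of n n i] by (simp add: s_def y_def)
  have t: "t = \<alpha> y (y + 1) * s + \<beta> y (y + 1) * U n (Suc n) $ i"
    using U_recurrence [of n "Suc n" i] by (simp add: t_def s_def y_def add.commute)
  have d: "d = 2 * (s + r y (y + 2) * U n (Suc n) $ i)"
    by (simp add: d_def U_Suc_component s_def y_def add.commute)
  have e: "e = 2 / 3 * (t + r y (y + 3) * s)"
    by (simp add: e_def U_Suc_component s_def t_def y_def add.commute)
  have "U (Suc n) (Suc (Suc (Suc n))) $ i = \<alpha> (y + 1) (y + 1) * e + \<beta> (y + 1) (y + 1) * d"
    using U_recurrence [of "Suc n" "Suc n" i] by (simp add: d_def e_def y_def add.commute)
  then have "U (Suc (Suc n)) (Suc (Suc n)) $ i
    = 2 * (\<alpha> (y + 1) (y + 1) * e + \<beta> (y + 1) (y + 1) * d + r (y + 1) (y + 3) * e)"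
    by (simp add: U_Suc_component [of "Suc n"] e_def y_def add.commute)
  also have "\<dots> = (65 * x^4 + 130 * x^3 + 105 * x^2 + 40 * x + 6) * (x + 1)^3 / 2 * d
    - x^9 * (16 * x^2 - 1) * (x + 1)^3 * U n n $ i"
    by (rule diagonal_identity [OF s t d e]) (simp add: x_def y_def)
  finally show ?thesis
    by (simp add: D_def d_def)
qed

lemma diagonal_component:
  assumes u: "solves_recurrence u"
    and "D 0 $ i = c * u 0" and "D 1 $ i = c * u 1 / 2"
  shows "D n $ i = (fact n)^7 / 2^n * (c * u n)"
proof (induction n rule: less_induct)
  case (less n)
  consider "n = 0" | "n = 1" | k where "n = k + 2"
    by (metis One_nat_def add_2_eq_Suc' not0_implies_Suc)
  then show ?case
  proof cases
    case (3 k)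
    define x where "x = (of_nat k + 1 :: rat)"
    have x: "x + 1 \<noteq> 0"
      unfolding x_def by linarith
    have rec: "4 * x^2 * (16 * x^2 - 1) * u k
       - (65 * x^4 + 130 * x^3 + 105 * x^2 + 40 * x + 6) * u (Suc k)
       + (x + 1)^4 * u (Suc (Suc k)) = 0"
      using u [unfolded solves_recurrence_def, rule_format, of "Suc k"]
      by (simp add: x_def Let_def add.commute)
    then have top: "(x + 1)^4 * u (Suc (Suc k))
      = (65 * x^4 + 130 * x^3 + 105 * x^2 + 40 * x + 6) * u (Suc k)
        - 4 * x^2 * (16 * x^2 - 1) * u k"
      by (simp add: algebra_simps)
    \<comment> \<open>Each increase of the index multiplies this scaling by a seventh power over 2:
      first x^7 / 2, then (x + 1)^7 / 2.\<close>
    define F where "F = (fact k)^7 / (2::rat)^k * c"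
    have D0: "D k $ i = F * u k"
      using less [of k] 3 by (simp add: F_def)
    have D1: "D (k + 1) $ i = x^7 / 2 * F * u (Suc k)"
      using less [of "k + 1"] 3 by (simp add: F_def x_def power_mult_distrib add.commute)
    have "D n $ i = (65 * x^4 + 130 * x^3 + 105 * x^2 + 40 * x + 6) * (x + 1)^3 / 2
        * (x^7 / 2 * F * u (Suc k)) - x^9 * (16 * x^2 - 1) * (x + 1)^3 * (F * u k)"
      unfolding 3 diagonal_recurrence D0 D1 x_def ..
    also have "\<dots> = (x + 1)^3 * x^7 / 4 * F * ((x + 1)^4 * u (Suc (Suc k)))"
      unfolding top by algebra
    also have "\<dots> = (fact n)^7 / 2^n * (c * u n)"
    proof -
      have "(fact n :: rat) = (x + 1) * x * fact k"
        by (simp add: 3 x_def algebra_simps)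
      then have "(fact n :: rat)^7 = (x + 1)^7 * x^7 * (fact k)^7"
        by (simp only: power_mult_distrib)
      then show ?thesis
        \<comment> \<open>The instance of \<open>power_add\<close> splits a seventh power into a
          cube, from the diagonal recurrence, and a fourth power, from the recurrence of
          \<open>u\<close>.\<close>
        by (simp add: F_def 3 power_add [of _ 3 4, simplified])
    qed
    finally show ?thesis .
  qed (use assms in auto)
qed

theorem proposition2p3:
  fixes A C :: "nat \<Rightarrow> rat" and n :: nat
  assumes "solves_recurrence A" and "A 0 = 1" and "A 1 = 6"
    and "solves_recurrence C" and "C 0 = 0" and "C 1 = 1"
  shows "D n = ((fact n)^7 / 2^n) *s vector [21/4 * C n, A n]"
proof -
  have D0: "D 0 $ 1 = 0" "D 0 $ 2 = 1"
    by (simp_all add: D_def E_def h_def)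
  \<comment> \<open>These values suffice for \<open>D 1\<close>: \<open>\<rho> 0 2\<close> is 0 and
    \<open>T 0 1\<close> is 2, so \<open>D 1\<close> is twice \<open>U 0 2\<close>. Its first entry
    21 / 8 forces the constant 21 / 4.\<close>
  have hE: "h (Suc (Suc 0)) = 3 / 2" "E (Suc (Suc 0)) = 7 / 8"
    by (simp_all add: h_def E_def fact_numeral)
  have D1: "D 1 $ 1 = 21 / 8" "D 1 $ 2 = 3"
    by (simp_all add: D_def U_Suc_component r_def hE)
  have "D n $ 1 = (fact n)^7 / 2^n * (21 / 4 * C n)"
    by (rule diagonal_component) (use assms D0 D1 in simp_all)
  moreover have "D n $ 2 = (fact n)^7 / 2^n * (1 * A n)"
    by (rule diagonal_component) (use assms D0 D1 in simp_all)
  ultimately show ?thesis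
    by (simp add: vec_eq_iff forall_2)
qed

end
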